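(* Let $n\ge 2$ and $m\ge 0$ be integers, and let $\alpha_0=0$ and $\alpha_1\neq 0$. Let $s$ be a root of the indicial equation $s(s-1)+(\beta_0/\alpha_1)s=0$, so $s\in\{0,\,1-\beta_0/\alpha_1\}$. The second-order linear differential equation $$\Big(\sum_{k=1}^{n}\alpha_k r^k\Big)y''(r)+\Big(\sum_{k=0}^{n-1}\beta_k r^k\Big)y'(r)-\Big(\sum_{k=0}^{n-2}\tau_k r^k\Big)y(r)=0$$ admits the solution $y(r)=r^{s}\mathcal{P}_m(r)=r^{s}\sum_{i=0}^{m}\mathcal{C}_i r^i$ in the neighbourhood of the regular singular point $r=0$, where $\mathcal{P}_m$ is a polynomial of degree $m$, if $$\sum_{j=0}^{n-1}\Big[\alpha_{n-j}(\ell-n+j+s+2)(\ell-n+j+s+1)+\beta_{n-j-1}(\ell-n+j+s+2)-\tau_{n-j-2}\Big]\,\mathcal{C}_{\ell-n+j+2}=0$$ for all $\ell=0,1,2,\ldots,m+n-2$.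
   Context: The coefficients $\alpha_k,\beta_k,\tau_k$ and $\mathcal{C}_i$ are constants (real or complex numbers). Conventions: $\tau_i=0$ if $i<0$; $\mathcal{C}_i=0$ if $i<0$ or $i>m$; and $\mathcal{C}_m\neq 0$ since $\mathcal{P}_m$ has degree $m$. When $s$ is not a nonnegative integer, $r^s$ denotes the usual power function (e.g. for $r>0$), and the solution is understood away from $r=0$. *)

theory Defs
  imports "HOL-Analysis.Analysis"
begin

text \<open>
  The coefficients tau and C are indexed by integers, so that the convention that they vanish
  outside their range can be stated literally. All notions are polymorphic, to be used both for
  real and for complex constants (with a real, respectively complex, variable).
\<close>

definition ode_solution_on ::
    "nat \<Rightarrow> (nat \<Rightarrow> 'a) \<Rightarrow> (nat \<Rightarrow> 'a) \<Rightarrow> (int \<Rightarrow> 'a) \<Rightarrow> 'a set \<Rightarrow> ('a::real_normed_field \<Rightarrow> 'a) \<Rightarrow> bool"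
  where "ode_solution_on n \<alpha> \<beta> \<tau> D y \<longleftrightarrow>
    (\<exists>y' y''. \<forall>r\<in>D.
        (y has_field_derivative y' r) (at r) \<and>
        (y' has_field_derivative y'' r) (at r) \<and>
        (\<Sum>k=1..n. \<alpha> k * r ^ k) * y'' r + (\<Sum>k=0..n-1. \<beta> k * r ^ k) * y' r
          - (\<Sum>k=0..n-2. \<tau> (int k) * r ^ k) * y r = 0)"

definition indicial_root :: "(nat \<Rightarrow> 'a) \<Rightarrow> (nat \<Rightarrow> 'a) \<Rightarrow> 'a::field \<Rightarrow> bool"
  where "indicial_root \<alpha> \<beta> s \<longleftrightarrow> s * (s - 1) + (\<beta> 0 / \<alpha> 1) * s = 0"

definition recurrence ::
    "nat \<Rightarrow> nat \<Rightarrow> (nat \<Rightarrow> 'a) \<Rightarrow> (nat \<Rightarrow> 'a) \<Rightarrow> (int \<Rightarrow> 'a) \<Rightarrow> 'a \<Rightarrow> (int \<Rightarrow> 'a::field) \<Rightarrow> bool"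
  where "recurrence n m \<alpha> \<beta> \<tau> s C \<longleftrightarrow>
    (\<forall>l\<in>{0..m+n-2}.
      (\<Sum>j=0..n-1.
         (\<alpha> (n - j) * (of_int (int l - int n + int j) + s + 2) * (of_int (int l - int n + int j) + s + 1)
          + \<beta> (n - j - 1) * (of_int (int l - int n + int j) + s + 2)
          - \<tau> (int n - int j - 2))
         * C (int l - int n + int j + 2)) = 0)"

text \<open>
  The power r to the s. Integer exponents are treated separately because \<open>powr\<close> has
  \<open>0 powr 0 = 0\<close>, and is not the ordinary power at negative reals. For the remaining exponents it
  is the real power on the positive half-line, respectively the principal branch on the complex
  plane slit along the nonpositive reals.
\<close>

definition gen_power :: "'a \<Rightarrow> 'a \<Rightarrow> 'a::{real_normed_field, ln}"
  where "gen_power r s = (if s \<in> \<int> then r powi (THE k. of_int k = s) else r powr s)"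

text \<open>
  The (open) set on which that power is differentiable. For the real type, the complement of
  \<open>\<real>\<^sub>\<le>\<^sub>0\<close> is the open positive half-line.
\<close>

definition gen_power_domain :: "'a::real_normed_field \<Rightarrow> 'a set"
  where "gen_power_domain s =
    (if s \<in> \<nat> then UNIV else if s \<in> \<int> then - {0} else - \<real>\<^sub>\<le>\<^sub>0)"

end

theory Submission
  imports Defs
begin

text \<open>
  This is the substitution step of the Frobenius method. Inserting
  \<open>y = \<Sum>i\<le>m. C i * r^(s + i)\<close> into the equation, the term of index \<open>i\<close> meets the coefficients
  \<open>\<alpha> k\<close>, \<open>\<beta> (k - 1)\<close> and \<open>\<tau> (k - 2)\<close> in the same power \<open>r^(s + i + k - 2)\<close>. Collecting the terms
  with \<open>i + k - 2 = l\<close>, the coefficient of \<open>r^(s + l)\<close> is, up to the reindexing \<open>k = n - j\<close>, the left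
  side of the recurrence when \<open>0 \<le> l \<le> m + n - 2\<close>. The only other exponent that occurs is \<open>l = -1\<close>,
  produced by \<open>i = 0\<close>, \<open>k = 1\<close> alone; its coefficient is \<open>\<alpha> 1\<close> times the indicial polynomial,
  times \<open>C 0\<close>.

  The computation needs only how the powers \<open>r^(s + i)\<close> behave under differentiation and under
  multiplication by \<open>r\<close>, so these rules are isolated in the locale \<open>power_ladder\<close>. The locale
  is then instantiated by integer powers when \<open>s\<close> is an integer and by \<open>powr\<close> otherwise. The
  delicate instance is \<open>s \<in> \<nat>\<close>, where the solution is also claimed at \<open>r = 0\<close>: the rules fail for
  negative exponents there, but they hold after multiplication with the factors \<open>s + i\<close> and
  \<open>s + i - 1\<close> that differentiation brings along.
\<close>

section \<open>Substituting a Frobenius series into the equation\<close>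

text \<open>
  \<open>F i\<close> stands for \<open>r \<mapsto> r^(s + i)\<close>. The rules are demanded only with the weights
  with which the powers occur in \<open>y\<close>, \<open>y'\<close> and \<open>y''\<close>, since without the weights they are false
  for \<open>r = 0\<close>: for instance \<open>r * r^(-1) = r^0\<close> fails there.
\<close>

locale power_ladder =
  fixes s :: "'a::real_normed_field" and D :: "'a set" and F :: "int \<Rightarrow> 'a \<Rightarrow> 'a"
  assumes deriv1: "\<lbrakk>r \<in> D; i \<ge> 0\<rbrakk> \<Longrightarrow>
      (F i has_field_derivative (s + of_int i) * F (i - 1) r) (at r)"
    and deriv2: "\<lbrakk>r \<in> D; i \<ge> 0\<rbrakk> \<Longrightarrow>
      ((\<lambda>r. (s + of_int i) * F (i - 1) r) has_field_derivative
        (s + of_int i) * (s + of_int i - 1) * F (i - 2) r) (at r)"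
    and shift0: "\<lbrakk>r \<in> D; i \<ge> 0\<rbrakk> \<Longrightarrow> r * F i r = F (i + 1) r"
    and shift1: "\<lbrakk>r \<in> D; i \<ge> 0\<rbrakk> \<Longrightarrow> (s + of_int i) * (r * F (i - 1) r) = (s + of_int i) * F i r"
    and shift2: "\<lbrakk>r \<in> D; i \<ge> 0\<rbrakk> \<Longrightarrow>
      (s + of_int i) * (s + of_int i - 1) * (r * F (i - 2) r)
      = (s + of_int i) * (s + of_int i - 1) * F (i - 1) r"
begin

lemma power_mult0:
  assumes "r \<in> D" "i \<ge> 0"
  shows "r ^ k * F i r = F (i + int k) r"
proof (induction k)
  case (Suc k)
  have "r ^ Suc k * F i r = r * F (i + int k) r"
    using Suc by (simp add: mult.assoc)
  also have "\<dots> = F (i + int (Suc k)) r"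
    using shift0[of r "i + int k"] assms by (simp add: algebra_simps)
  finally show ?case .
qed simp

text \<open>
  The weight is used up by the first factor \<open>r\<close>, which lifts the index from \<open>i - 1\<close> to \<open>i \<ge> 0\<close>,
  where multiplication by further factors is unconditional; \<open>power_mult2\<close> descends one step more.
\<close>

lemma power_mult1:
  assumes "r \<in> D" "i \<ge> 0"
  shows "r ^ k * ((s + of_int i) * F (i - 1) r) = (s + of_int i) * F (i - 1 + int k) r"
proof (cases k)
  case (Suc k')
  have "r ^ k * ((s + of_int i) * F (i - 1) r) = r ^ k' * ((s + of_int i) * (r * F (i - 1) r))"
    by (simp add: Suc mult_ac)
  also have "\<dots> = (s + of_int i) * (r ^ k' * F i r)"
    by (subst shift1[OF assms]) (simp only: mult_ac)
  also have "\<dots> = (s + of_int i) * F (i - 1 + int k) r"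
    unfolding power_mult0[OF assms] by (simp add: Suc)
  finally show ?thesis .
qed simp

lemma power_mult2:
  assumes "r \<in> D" "i \<ge> 0"
  shows "r ^ k * ((s + of_int i) * (s + of_int i - 1) * F (i - 2) r)
    = (s + of_int i) * (s + of_int i - 1) * F (i - 2 + int k) r"
proof (cases k)
  case (Suc k')
  have "r ^ k * ((s + of_int i) * (s + of_int i - 1) * F (i - 2) r)
      = r ^ k' * ((s + of_int i) * (s + of_int i - 1) * (r * F (i - 2) r))"
    by (simp add: Suc mult_ac)
  also have "\<dots> = (s + of_int i - 1) * (r ^ k' * ((s + of_int i) * F (i - 1) r))"
    by (subst shift2[OF assms]) (simp only: mult_ac)
  also have "\<dots> = (s + of_int i - 1) * ((s + of_int i) * F (i - 1 + int k') r)"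
    using assms by (simp only: power_mult1)
  also have "\<dots> = (s + of_int i) * (s + of_int i - 1) * F (i - 2 + int k) r"
    by (simp add: Suc mult_ac algebra_simps)
  finally show ?thesis .
qed simp

end

text \<open>
  The factor with which \<open>C i\<close> enters the coefficient of \<open>r^(s + i + k - 2)\<close>; its case
  \<open>i = 0\<close>, \<open>k = 1\<close> is \<open>\<alpha> 1\<close> times the indicial polynomial, provided \<open>\<tau> (-1) = 0\<close>.
\<close>

definition frobenius_coeff ::
    "(nat \<Rightarrow> 'a) \<Rightarrow> (nat \<Rightarrow> 'a) \<Rightarrow> (int \<Rightarrow> 'a) \<Rightarrow> 'a \<Rightarrow> int \<Rightarrow> nat \<Rightarrow> 'a::field"
  where "frobenius_coeff \<alpha> \<beta> \<tau> s i k =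
    \<alpha> k * (s + of_int i) * (s + of_int i - 1) + \<beta> (k - 1) * (s + of_int i) - \<tau> (int k - 2)"

lemma recurrence_eq_frobenius_coeff:
  assumes "recurrence n m \<alpha> \<beta> \<tau> s C" "n \<ge> 2" "0 \<le> l" "l \<le> int (m + n - 2)"
  shows "(\<Sum>k=1..n. frobenius_coeff \<alpha> \<beta> \<tau> s (l - int k + 2) k * C (l - int k + 2)) = 0"
proof -
  have "nat l \<in> {0..m + n - 2}"
    using assms by auto
  with assms(1) have "(\<Sum>j=0..n-1.
         (\<alpha> (n - j) * (of_int (int (nat l) - int n + int j) + s + 2)
            * (of_int (int (nat l) - int n + int j) + s + 1)
          + \<beta> (n - j - 1) * (of_int (int (nat l) - int n + int j) + s + 2)
          - \<tau> (int n - int j - 2))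
         * C (int (nat l) - int n + int j + 2)) = 0" (is "?S = 0")
    unfolding recurrence_def by blast
  moreover have "(\<Sum>k=1..n. frobenius_coeff \<alpha> \<beta> \<tau> s (l - int k + 2) k * C (l - int k + 2)) = ?S"
    using assms(2,3)
    by (intro sum.reindex_bij_witness[where i = "\<lambda>j. n - j" and j = "\<lambda>k. n - k"])
       (auto simp: frobenius_coeff_def of_nat_diff algebra_simps)
  ultimately show ?thesis by simp
qed

lemma indicial_root_imp_frobenius_coeff:
  assumes "indicial_root \<alpha> \<beta> s" "\<alpha> 1 \<noteq> 0" "\<tau> (-1) = 0"
  shows "frobenius_coeff \<alpha> \<beta> \<tau> s 0 1 = 0"
proof -
  have "frobenius_coeff \<alpha> \<beta> \<tau> s 0 1 = \<alpha> 1 * (s * (s - 1) + (\<beta> 0 / \<alpha> 1) * s)"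
    using assms(2,3) by (simp add: frobenius_coeff_def algebra_simps)
  with assms(1) show ?thesis by (simp add: indicial_root_def)
qed

text \<open>
  Collecting the terms of the double sum along the diagonals \<open>i + k - 2 = l\<close>. Since \<open>C\<close> vanishes
  outside \<open>{0..m}\<close>, each diagonal may be taken over all \<open>k\<close>.
\<close>

lemma sum_frobenius_coeff_eq_0:
  fixes C :: "int \<Rightarrow> 'a::field" and G :: "int \<Rightarrow> 'a"
  assumes n: "n \<ge> 2" and \<alpha>1: "\<alpha> 1 \<noteq> 0" and \<tau>: "\<forall>i<0. \<tau> i = 0"
    and C: "\<forall>i. i < 0 \<or> i > int m \<longrightarrow> C i = 0"
    and ind: "indicial_root \<alpha> \<beta> s" and rec: "recurrence n m \<alpha> \<beta> \<tau> s C"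
  shows "(\<Sum>i=0..int m. \<Sum>k=1..n. frobenius_coeff \<alpha> \<beta> \<tau> s i k * C i * G (i - 2 + int k)) = 0"
proof -
  let ?T = "frobenius_coeff \<alpha> \<beta> \<tau> s"
  let ?L = "{-1..int (m + n - 2)}"
  have diag: "(\<Sum>k=1..n. ?T (l - int k + 2) k * C (l - int k + 2)) = 0" if "l \<in> ?L" for l
  proof (cases "l = -1")
    case True
    have "(\<Sum>k=1..n. ?T (l - int k + 2) k * C (l - int k + 2))
        = (\<Sum>k\<in>{1}. ?T (l - int k + 2) k * C (l - int k + 2))"
      using n C True by (intro sum.mono_neutral_right) auto
    also have "\<dots> = 0"
      using indicial_root_imp_frobenius_coeff[OF ind \<alpha>1] \<tau> True by simp
    finally show ?thesis .
  next
    case False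
    with that show ?thesis
      by (intro recurrence_eq_frobenius_coeff[OF rec n]) auto
  qed
  have "(\<Sum>i=0..int m. \<Sum>k=1..n. ?T i k * C i * G (i - 2 + int k))
      = (\<Sum>k=1..n. \<Sum>i=0..int m. ?T i k * C i * G (i - 2 + int k))"
    by (rule sum.swap)
  also have "\<dots> = (\<Sum>k=1..n. \<Sum>l\<in>?L. ?T (l - int k + 2) k * C (l - int k + 2) * G l)"
  proof (rule sum.cong[OF refl])
    fix k assume k: "k \<in> {1..n}"
    have "(\<Sum>i=0..int m. ?T i k * C i * G (i - 2 + int k))
        = (\<Sum>l\<in>{int k - 2..int m + int k - 2}. ?T (l - int k + 2) k * C (l - int k + 2) * G l)"
      by (rule sum.reindex_bij_witness[where i = "\<lambda>l. l - int k + 2" and j = "\<lambda>i. i - 2 + int k"])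
         auto
    also have "\<dots> = (\<Sum>l\<in>?L. ?T (l - int k + 2) k * C (l - int k + 2) * G l)"
      using k n C by (intro sum.mono_neutral_left) auto
    finally show "(\<Sum>i=0..int m. ?T i k * C i * G (i - 2 + int k))
        = (\<Sum>l\<in>?L. ?T (l - int k + 2) k * C (l - int k + 2) * G l)" .
  qed
  also have "\<dots> = (\<Sum>l\<in>?L. \<Sum>k=1..n. ?T (l - int k + 2) k * C (l - int k + 2) * G l)"
    by (rule sum.swap)
  also have "\<dots> = (\<Sum>l\<in>?L. (\<Sum>k=1..n. ?T (l - int k + 2) k * C (l - int k + 2)) * G l)"
    by (simp add: sum_distrib_right)
  also have "\<dots> = 0"
    using diag by simp
  finally show ?thesis .
qed

context power_ladder
begin

text \<open>
  The sums over \<open>\<beta>\<close> and \<open>\<tau>\<close> are shifted by one and two places, so that all three terms of index \<open>k\<close>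
  carry the same power; the shifted \<open>\<tau>\<close>-sum may start at \<open>k = 1\<close> because \<open>\<tau> (-1) = 0\<close>.
\<close>

lemma frobenius_operator_single:
  assumes r: "r \<in> D" and i: "i \<ge> 0" and n: "n \<ge> 2" and \<tau>: "\<forall>i<0. \<tau> i = 0"
  shows "(\<Sum>k=1..n. \<alpha> k * r ^ k) * ((s + of_int i) * (s + of_int i - 1) * F (i - 2) r)
      + (\<Sum>k=0..n-1. \<beta> k * r ^ k) * ((s + of_int i) * F (i - 1) r)
      - (\<Sum>k=0..n-2. \<tau> (int k) * r ^ k) * F i r
    = (\<Sum>k=1..n. frobenius_coeff \<alpha> \<beta> \<tau> s i k * F (i - 2 + int k) r)"
proof -
  have A: "(\<Sum>k=1..n. \<alpha> k * r ^ k) * ((s + of_int i) * (s + of_int i - 1) * F (i - 2) r)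
      = (\<Sum>k=1..n. \<alpha> k * ((s + of_int i) * (s + of_int i - 1) * F (i - 2 + int k) r))"
    by (simp only: sum_distrib_right mult.assoc[of "\<alpha> _"] power_mult2[OF r i])
  have "(\<Sum>k=0..n-1. \<beta> k * r ^ k) * ((s + of_int i) * F (i - 1) r)
      = (\<Sum>k=0..n-1. \<beta> k * ((s + of_int i) * F (i - 1 + int k) r))"
    by (simp only: sum_distrib_right mult.assoc[of "\<beta> _"] power_mult1[OF r i])
  also have "\<dots> = (\<Sum>k=1..n. \<beta> (k - 1) * ((s + of_int i) * F (i - 2 + int k) r))"
    using n by (intro sum.reindex_bij_witness[where i = "\<lambda>k. k - 1" and j = Suc])
               (auto simp: algebra_simps)
  finally have B: "(\<Sum>k=0..n-1. \<beta> k * r ^ k) * ((s + of_int i) * F (i - 1) r)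
      = (\<Sum>k=1..n. \<beta> (k - 1) * ((s + of_int i) * F (i - 2 + int k) r))" .
  have "(\<Sum>k=0..n-2. \<tau> (int k) * r ^ k) * F i r = (\<Sum>k=0..n-2. \<tau> (int k) * F (i + int k) r)"
    by (simp only: sum_distrib_right mult.assoc[of "\<tau> _"] power_mult0[OF r i])
  also have "\<dots> = (\<Sum>k=2..n. \<tau> (int k - 2) * F (i - 2 + int k) r)"
    using n by (intro sum.reindex_bij_witness[where i = "\<lambda>k. k - 2" and j = "\<lambda>k. k + 2"])
               (auto simp: algebra_simps)
  also have "\<dots> = (\<Sum>k=1..n. \<tau> (int k - 2) * F (i - 2 + int k) r)"
    using \<tau> by (intro sum.mono_neutral_left) auto
  finally have T: "(\<Sum>k=0..n-2. \<tau> (int k) * r ^ k) * F i r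
      = (\<Sum>k=1..n. \<tau> (int k - 2) * F (i - 2 + int k) r)" .
  show ?thesis
    unfolding A B T sum.distrib[symmetric] sum_subtractf[symmetric]
    by (rule sum.cong) (simp_all add: frobenius_coeff_def algebra_simps)
qed

lemma frobenius_solution:
  assumes n: "n \<ge> 2" and \<alpha>1: "\<alpha> 1 \<noteq> 0" and \<tau>: "\<forall>i<0. \<tau> i = 0"
    and C: "\<forall>i. i < 0 \<or> i > int m \<longrightarrow> C i = 0"
    and ind: "indicial_root \<alpha> \<beta> s" and rec: "recurrence n m \<alpha> \<beta> \<tau> s C"
  shows "ode_solution_on n \<alpha> \<beta> \<tau> D (\<lambda>r. \<Sum>i=0..int m. C i * F i r)"
proof -
  let ?y = "\<lambda>r. \<Sum>i=0..int m. C i * F i r"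
  let ?y' = "\<lambda>r. \<Sum>i=0..int m. C i * ((s + of_int i) * F (i - 1) r)"
  let ?y'' = "\<lambda>r. \<Sum>i=0..int m. C i * ((s + of_int i) * (s + of_int i - 1) * F (i - 2) r)"
  have "(?y has_field_derivative ?y' r) (at r) \<and> (?y' has_field_derivative ?y'' r) (at r) \<and>
      (\<Sum>k=1..n. \<alpha> k * r ^ k) * ?y'' r + (\<Sum>k=0..n-1. \<beta> k * r ^ k) * ?y' r
        - (\<Sum>k=0..n-2. \<tau> (int k) * r ^ k) * ?y r = 0" if r: "r \<in> D" for r
  proof (intro conjI)
    show "(?y has_field_derivative ?y' r) (at r)"
      using r by (intro DERIV_sum DERIV_cmult deriv1) auto
    show "(?y' has_field_derivative ?y'' r) (at r)"
      using r by (intro DERIV_sum DERIV_cmult deriv2) auto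
    let ?a = "\<Sum>k=1..n. \<alpha> k * r ^ k" and ?b = "\<Sum>k=0..n-1. \<beta> k * r ^ k"
      and ?t = "\<Sum>k=0..n-2. \<tau> (int k) * r ^ k"
    have "?a * ?y'' r + ?b * ?y' r - ?t * ?y r
      = (\<Sum>i=0..int m. C i * (?a * ((s + of_int i) * (s + of_int i - 1) * F (i - 2) r)
          + ?b * ((s + of_int i) * F (i - 1) r) - ?t * F i r))"
      unfolding sum_distrib_left[of ?a] sum_distrib_left[of ?b] sum_distrib_left[of ?t]
        sum.distrib[symmetric] sum_subtractf[symmetric]
      by (simp only: distrib_left right_diff_distrib mult.left_commute[of "C _"])
    also have "\<dots> = (\<Sum>i=0..int m. C i *
        (\<Sum>k=1..n. frobenius_coeff \<alpha> \<beta> \<tau> s i k * F (i - 2 + int k) r))"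
      by (rule sum.cong[OF refl], subst frobenius_operator_single[OF r _ n \<tau>]) auto
    also have "\<dots> = (\<Sum>i=0..int m. \<Sum>k=1..n.
        frobenius_coeff \<alpha> \<beta> \<tau> s i k * C i * F (i - 2 + int k) r)"
      by (simp only: sum_distrib_left mult_ac)
    also have "\<dots> = 0"
      by (rule sum_frobenius_coeff_eq_0[OF n \<alpha>1 \<tau> C ind rec])
    finally show "?a * ?y'' r + ?b * ?y' r - ?t * ?y r = 0" .
  qed
  then show ?thesis
    unfolding ode_solution_on_def by (intro exI[of _ ?y'] exI[of _ ?y''] ballI)
qed

end

section \<open>The families of powers\<close>

lemma gen_power_of_int: "gen_power r (of_int k :: 'a::{real_normed_field, ln}) = r powi k"
  by (simp add: gen_power_def)

text \<open>
  At \<open>r = 0\<close> the exponents are \<open>k + i \<ge> 0\<close>. The rules for the exponents \<open>k + i - 1\<close> and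
  \<open>k + i - 2\<close> can only fail when one of these is negative, hence when \<open>k + i \<in> {0, 1}\<close>, and
  then the weight \<open>k + i\<close> or \<open>(k + i) * (k + i - 1)\<close> is zero.
\<close>

lemma power_ladder_powi:
  fixes D :: "'a::real_normed_field set"
  assumes D: "k \<ge> 0 \<or> 0 \<notin> D"
  shows "power_ladder (of_int k) D (\<lambda>i r. r powi (k + i))"
proof -
  have shift: "r * r powi j = r powi (j + 1)" if "j \<noteq> -1 \<or> r \<noteq> 0" for r :: 'a and j
    using that by (subst power_int_add_1') auto
  have deriv: "((\<lambda>r. r powi j) has_field_derivative of_int j * r powi (j - 1)) (at r)"
    if "j \<ge> 0 \<or> r \<noteq> 0" for r :: 'a and j
    using DERIV_power_int[OF DERIV_ident, of j r UNIV] that by simp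
  show ?thesis
  proof
    fix r :: 'a and i :: int
    assume r: "r \<in> D" and i: "i \<ge> 0"
    define e where "e = k + i"
    have e: "e \<ge> 0 \<or> r \<noteq> 0"
      using D r i by (auto simp: e_def)
    have idx: "k + (i - 1) = e - 1" "k + (i - 2) = e - 2" "k + (i + 1) = e + 1" "k + i = e"
      and w: "of_int k + of_int i = (of_int e :: 'a)"
      by (simp_all add: e_def)
    show "((\<lambda>r. r powi (k + i)) has_field_derivative
        (of_int k + of_int i) * r powi (k + (i - 1))) (at r)"
      unfolding idx w by (rule deriv[OF e])
    show "((\<lambda>r. (of_int k + of_int i) * r powi (k + (i - 1))) has_field_derivative
        (of_int k + of_int i) * (of_int k + of_int i - 1) * r powi (k + (i - 2))) (at r)"
    proof (cases "e = 0")
      case False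
      with e have "e - 1 \<ge> 0 \<or> r \<noteq> 0" by auto
      from DERIV_cmult[OF deriv[OF this], of "of_int e"] show ?thesis
        unfolding idx w by (simp add: mult.assoc)
    qed (simp add: idx w)
    show "r * r powi (k + i) = r powi (k + (i + 1))"
      unfolding idx using e by (intro shift) auto
    show "(of_int k + of_int i) * (r * r powi (k + (i - 1)))
        = (of_int k + of_int i) * r powi (k + i)"
      unfolding idx w using shift[of "e - 1" r] e by (cases "e = 0") auto
    show "(of_int k + of_int i) * (of_int k + of_int i - 1) * (r * r powi (k + (i - 2)))
        = (of_int k + of_int i) * (of_int k + of_int i - 1) * r powi (k + (i - 1))"
      unfolding idx w using shift[of "e - 2" r] e by (cases "e = 1") auto
  qed
qed

text \<open>
  The two rules assumed for \<open>powr\<close> depend on the logarithm of the field, which the class \<open>ln\<close>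
  leaves unspecified; taking them as hypotheses serves the real and the complex case at once.
\<close>

lemma power_ladder_powr:
  fixes s :: "'a::{real_normed_field, ln}"
  assumes one: "\<And>r::'a. r \<in> D \<Longrightarrow> r powr 1 = r"
    and deriv: "\<And>(r::'a) a. r \<in> D \<Longrightarrow>
      ((\<lambda>r. r powr a) has_field_derivative a * r powr (a - 1)) (at r)"
  shows "power_ladder s D (\<lambda>i r. r powr (s + of_int i))"
proof -
  have shift: "r * r powr a = r powr (a + 1)" if "r \<in> D" for r a
    using one[OF that] by (simp add: powr_add)
  show ?thesis
  proof
    fix r :: 'a and i :: int
    assume r: "r \<in> D"
    let ?e = "s + of_int i"
    have idx: "s + of_int (i - 1) = ?e - 1" "s + of_int (i - 2) = ?e - 1 - 1"
      "s + of_int (i + 1) = ?e + 1"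
      by simp_all
    show "((\<lambda>r. r powr ?e) has_field_derivative ?e * r powr (s + of_int (i - 1))) (at r)"
      unfolding idx by (rule deriv[OF r])
    show "((\<lambda>r. ?e * r powr (s + of_int (i - 1))) has_field_derivative
        ?e * (?e - 1) * r powr (s + of_int (i - 2))) (at r)"
      unfolding idx mult.assoc by (intro DERIV_cmult deriv r)
    show "r * r powr ?e = r powr (s + of_int (i + 1))"
      unfolding idx by (rule shift[OF r])
    show "?e * (r * r powr (s + of_int (i - 1))) = ?e * r powr ?e"
      unfolding idx shift[OF r] by simp
    show "?e * (?e - 1) * (r * r powr (s + of_int (i - 2)))
        = ?e * (?e - 1) * r powr (s + of_int (i - 1))"
      unfolding idx shift[OF r] by simp
  qed
qed

lemma powr_mult_power:
  fixes r :: "'a::{real_normed_field, ln}"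
  assumes "r powr 1 = r"
  shows "r powr s * r ^ i = r powr (s + of_nat i)"
proof (induction i)
  case (Suc i)
  have "r powr s * r ^ Suc i = (r powr s * r ^ i) * r powr 1"
    by (simp add: assms)
  also have "\<dots> = r powr (s + of_nat (Suc i))"
    by (simp only: Suc powr_add[symmetric]) (simp add: add_ac)
  finally show ?case .
qed simp

lemma powi_mult_power:
  fixes r :: "'a::field"
  assumes "k \<ge> 0 \<or> r \<noteq> 0"
  shows "r powi k * r ^ i = r powi (k + int i)"
  using assms by (cases "i = 0") (auto simp: power_int_add)

section \<open>The solutions\<close>

text \<open>
  Needed because \<open>gen_power r s * r^i\<close> and the power \<open>r^(s + i)\<close> may differ outside the domain:
  for \<open>s = -1\<close>, \<open>i = 1\<close> and \<open>r = 0\<close>, the product is \<open>0\<close> and the power is \<open>1\<close>.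
\<close>

lemma ode_solution_on_cong:
  assumes sol: "ode_solution_on n \<alpha> \<beta> \<tau> D y" and "open D"
    and eq: "\<And>r. r \<in> D \<Longrightarrow> y r = z r"
  shows "ode_solution_on n \<alpha> \<beta> \<tau> D z"
proof -
  have deriv: "(z has_field_derivative d) (at r)" if "(y has_field_derivative d) (at r)" "r \<in> D" for d r
    using has_field_derivative_transform_within_open[OF that(1) \<open>open D\<close> that(2) eq] .
  obtain y' y'' where y: "\<forall>r\<in>D. (y has_field_derivative y' r) (at r) \<and>
      (y' has_field_derivative y'' r) (at r) \<and>
      (\<Sum>k=1..n. \<alpha> k * r ^ k) * y'' r + (\<Sum>k=0..n-1. \<beta> k * r ^ k) * y' r
        - (\<Sum>k=0..n-2. \<tau> (int k) * r ^ k) * y r = 0"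
    using sol unfolding ode_solution_on_def by (elim exE)
  show ?thesis
    unfolding ode_solution_on_def
    using y deriv by (intro exI[of _ y'] exI[of _ y''] ballI) (simp add: eq[symmetric])
qed

lemma frobenius_gen_power_solution:
  fixes s :: "'a::{real_normed_field, ln}" and C :: "int \<Rightarrow> 'a"
  assumes one: "\<And>r::'a. r \<notin> \<real>\<^sub>\<le>\<^sub>0 \<Longrightarrow> r powr 1 = r"
    and deriv: "\<And>(r::'a) a. r \<notin> \<real>\<^sub>\<le>\<^sub>0 \<Longrightarrow>
      ((\<lambda>r. r powr a) has_field_derivative a * r powr (a - 1)) (at r)"
    and closed: "closed (\<real>\<^sub>\<le>\<^sub>0 :: 'a set)"
    and n: "n \<ge> 2" and \<alpha>1: "\<alpha> 1 \<noteq> 0" and \<tau>: "\<forall>i<0. \<tau> i = 0"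
    and C: "\<forall>i. i < 0 \<or> i > int m \<longrightarrow> C i = 0"
    and ind: "indicial_root \<alpha> \<beta> s" and rec: "recurrence n m \<alpha> \<beta> \<tau> s C"
  shows "ode_solution_on n \<alpha> \<beta> \<tau> (gen_power_domain s)
    (\<lambda>r. gen_power r s * (\<Sum>i=0..m. C (int i) * r ^ i))"
proof -
  let ?D = "gen_power_domain s"
  obtain F where F: "power_ladder s ?D F"
    and eq: "\<And>r i. r \<in> ?D \<Longrightarrow> F (int i) r = gen_power r s * r ^ i"
  proof (cases "s \<in> \<int>")
    case True
    then obtain k where k: "s = of_int k"
      by (auto elim: Ints_cases)
    have D: "k \<ge> 0 \<or> 0 \<notin> ?D"
    proof (cases "s \<in> \<nat>")
      case True
      then obtain j where "s = of_nat j"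
        by (auto elim: Nats_cases)
      with k have "of_int k = (of_int (int j) :: 'a)"
        by simp
      then show ?thesis
        unfolding of_int_eq_iff by simp
    qed (simp add: gen_power_domain_def True)
    show thesis
    proof (rule that)
      show "power_ladder s ?D (\<lambda>i r. r powi (k + i))"
        using power_ladder_powi[OF D] by (simp only: k)
      show "r powi (k + int i) = gen_power r s * r ^ i" if "r \<in> ?D" for r i
        unfolding k gen_power_of_int using D that by (subst powi_mult_power) auto
    qed
  next
    case False
    moreover have "s \<notin> \<nat>"
      using False Nats_subset_Ints by auto
    ultimately have D: "?D = - \<real>\<^sub>\<le>\<^sub>0"
      by (simp add: gen_power_domain_def)
    show thesis
    proof (rule that)
      show "power_ladder s ?D (\<lambda>i r. r powr (s + of_int i))"
        by (rule power_ladder_powr) (auto simp: D intro: one deriv)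
      show "r powr (s + of_int (int i)) = gen_power r s * r ^ i" if "r \<in> ?D" for r i
        using that False by (simp add: D gen_power_def powr_mult_power one)
    qed
  qed
  have "open ?D"
    using closed by (auto simp: gen_power_domain_def)
  show ?thesis
  proof (rule ode_solution_on_cong[OF _ \<open>open ?D\<close>])
    show "ode_solution_on n \<alpha> \<beta> \<tau> ?D (\<lambda>r. \<Sum>i=0..int m. C i * F i r)"
      by (rule power_ladder.frobenius_solution[OF F n \<alpha>1 \<tau> C ind rec])
    fix r assume r: "r \<in> ?D"
    have "(\<Sum>i=0..int m. C i * F i r) = (\<Sum>i=0..m. C (int i) * F (int i) r)"
      by (rule sum.reindex_bij_witness[where i = int and j = nat]) auto
    also have "\<dots> = gen_power r s * (\<Sum>i=0..m. C (int i) * r ^ i)"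
      by (simp only: eq[OF r] sum_distrib_left mult_ac)
    finally show "(\<Sum>i=0..int m. C i * F i r) = gen_power r s * (\<Sum>i=0..m. C (int i) * r ^ i)" .
  qed
qed

theorem theorem4p2:
  fixes n m :: nat
  assumes "n \<ge> 2"
  shows
    "(\<forall>(\<alpha> :: nat \<Rightarrow> real) (\<beta> :: nat \<Rightarrow> real) (\<tau> :: int \<Rightarrow> real) (C :: int \<Rightarrow> real) (s :: real).
        \<alpha> 0 = 0 \<and> \<alpha> 1 \<noteq> 0 \<and>
        (\<forall>i<0. \<tau> i = 0) \<and>
        (\<forall>i. i < 0 \<or> i > int m \<longrightarrow> C i = 0) \<and> C (int m) \<noteq> 0 \<and>
        indicial_root \<alpha> \<beta> s \<and>
        recurrence n m \<alpha> \<beta> \<tau> s C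
        \<longrightarrow> ode_solution_on n \<alpha> \<beta> \<tau> (gen_power_domain s)
              (\<lambda>r. gen_power r s * (\<Sum>i=0..m. C (int i) * r ^ i)))
     \<and>
     (\<forall>(\<alpha> :: nat \<Rightarrow> complex) (\<beta> :: nat \<Rightarrow> complex) (\<tau> :: int \<Rightarrow> complex) (C :: int \<Rightarrow> complex) (s :: complex).
        \<alpha> 0 = 0 \<and> \<alpha> 1 \<noteq> 0 \<and>
        (\<forall>i<0. \<tau> i = 0) \<and>
        (\<forall>i. i < 0 \<or> i > int m \<longrightarrow> C i = 0) \<and> C (int m) \<noteq> 0 \<and>
        indicial_root \<alpha> \<beta> s \<and>
        recurrence n m \<alpha> \<beta> \<tau> s C
        \<longrightarrow> ode_solution_on n \<alpha> \<beta> \<tau> (gen_power_domain s)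
              (\<lambda>r. gen_power r s * (\<Sum>i=0..m. C (int i) * r ^ i)))"
proof (intro conjI allI impI; elim conjE)
  have nonpos: "(\<real>\<^sub>\<le>\<^sub>0 :: real set) = {..0}"
    by (auto simp: nonpos_Reals_def)
  fix \<alpha> \<beta> :: "nat \<Rightarrow> real" and \<tau> C :: "int \<Rightarrow> real" and s :: real
  assume "\<alpha> 1 \<noteq> 0" "\<forall>i<0. \<tau> i = 0" "\<forall>i. i < 0 \<or> i > int m \<longrightarrow> C i = 0"
    "indicial_root \<alpha> \<beta> s" "recurrence n m \<alpha> \<beta> \<tau> s C"
  then show "ode_solution_on n \<alpha> \<beta> \<tau> (gen_power_domain s)
      (\<lambda>r. gen_power r s * (\<Sum>i=0..m. C (int i) * r ^ i))"
  proof (rule frobenius_gen_power_solution[where \<alpha> = \<alpha> and C = C, OF _ _ _ assms, rotated 3])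
    fix r :: real
    assume "r \<notin> \<real>\<^sub>\<le>\<^sub>0"
    then have r: "r > 0"
      by (simp add: nonpos)
    then show "r powr 1 = r"
      by simp
    show "((\<lambda>r. r powr a) has_field_derivative a * r powr (a - 1)) (at r)" for a
      by (rule has_real_derivative_powr[OF r])
  next
    show "closed (\<real>\<^sub>\<le>\<^sub>0 :: real set)"
      by (simp add: nonpos)
  qed
next
  fix \<alpha> \<beta> :: "nat \<Rightarrow> complex" and \<tau> C :: "int \<Rightarrow> complex" and s :: complex
  assume "\<alpha> 1 \<noteq> 0" "\<forall>i<0. \<tau> i = 0" "\<forall>i. i < 0 \<or> i > int m \<longrightarrow> C i = 0"
    "indicial_root \<alpha> \<beta> s" "recurrence n m \<alpha> \<beta> \<tau> s C"
  then show "ode_solution_on n \<alpha> \<beta> \<tau> (gen_power_domain s)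
      (\<lambda>r. gen_power r s * (\<Sum>i=0..m. C (int i) * r ^ i))"
  proof (rule frobenius_gen_power_solution[where \<alpha> = \<alpha> and C = C, OF _ _ _ assms, rotated 3])
    fix r :: complex
    assume r: "r \<notin> \<real>\<^sub>\<le>\<^sub>0"
    then have "r \<noteq> 0"
      by auto
    then show "r powr 1 = r"
      using powr_complexpow[of r 1] by simp
    show "((\<lambda>r. r powr a) has_field_derivative a * r powr (a - 1)) (at r)" for a
      by (rule has_field_derivative_powr[OF r])
  qed simp
qed

end
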